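(* Let $m\ge 2$ and let $v,w\in(R_\infty)^m$, where $R_\infty=(\mathbb{Z},* )$ with $a*b=2b-a$. The following are equivalent. (1) There exists a pure $m$-braid $\beta\in P_m$ such that $v\cdot\beta=w$. (2) $\Delta(v)=\Delta(w)$, $d(v)=d(w)$, and $M^*(v)=M^*(w)$.
   Context: The universal dihedral quandle $R_\infty$ is the set $\mathbb{Z}$ with operation $a*b=2b-a$; thus $(R_\infty)^m=\mathbb{Z}^m$ as a set. $B_m$ is the $m$-braid group with standard generators $\sigma_1,\dots,\sigma_{m-1}$ (relations $\sigma_i\sigma_j=\sigma_j\sigma_i$ for $|i-j|\ge2$ and $\sigma_i\sigma_{i+1}\sigma_i=\sigma_{i+1}\sigma_i\sigma_{i+1}$). The Hurwitz action is the right action of $B_m$ on $\mathbb{Z}^m$ given by $(a_1,\dots,a_i,a_{i+1},\dots,a_m)\cdot\sigma_i=(a_1,\dots,a_{i-1},a_{i+1},2a_{i+1}-a_i,a_{i+2},\dots,a_m)$. Each $\beta\in B_m$ has an associated permutation $\pi_\beta\in S_m$: $\beta$ connects the $k$th top point to the $\pi_\beta(k)$th bottom point (so $\pi_{\sigma_i}$ is the transposition $(i\ i+1)$). The pure $m$-braid group is $P_m=\{\beta\in B_m\mid\pi_\beta=e\}$, acting on $\mathbb{Z}^m$ by restriction. For $v=(a_1,\dots,a_m)\in\mathbb{Z}^m$: $v$ is trivial if $a_1=\dots=a_m$, and nontrivial otherwise. $\Delta(v)=\sum_{i=1}^m(-1)^{i-1}a_i$. $d(v)=0$ if $v$ is trivial,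 and $d(v)=\gcd\{a_i-a_j\mid 1\le i,j\le m\}>0$ if $v$ is nontrivial. $M^*(v)=(a_1,\dots,a_m)\in(\mathbb{Z}/2d(v)\mathbb{Z})^m$ is the ordered $m$-tuple of congruence classes of the $a_i$ modulo $2d(v)$, with the convention that if $d(v)=0$, the class of $a_i$ is the integer $a_i$ itself. *)

theory Defs
  imports Complex_Main "HOL-Algebra.Group" "HOL-Combinatorics.Transposition" "HOL-Number_Theory.Cong"
begin

section \<open>Braid groups by generators and relations\<close>

text \<open>Words in the standard generators and their formal inverses. Generators are numbered
  \<open>1, \<dots>, m - 1\<close>.\<close>

datatype braid_letter = Gen nat | GenInv nat

fun gen_index :: "braid_letter \<Rightarrow> nat" where
  "gen_index (Gen i) = i"
| "gen_index (GenInv i) = i"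

definition braid_words :: "nat \<Rightarrow> braid_letter list set" where
  "braid_words m = {w. \<forall>x\<in>set w. 1 \<le> gen_index x \<and> gen_index x < m}"

inductive braid_relation :: "braid_letter list \<Rightarrow> braid_letter list \<Rightarrow> bool" where
  inv_right: "braid_relation [Gen i, GenInv i] []"
| inv_left: "braid_relation [GenInv i, Gen i] []"
| far_comm: "i + 2 \<le> j \<or> j + 2 \<le> i \<Longrightarrow> braid_relation [Gen i, Gen j] [Gen j, Gen i]"
| braid: "braid_relation [Gen i, Gen (i + 1), Gen i] [Gen (i + 1), Gen i, Gen (i + 1)]"

inductive braid_equiv :: "nat \<Rightarrow> braid_letter list \<Rightarrow> braid_letter list \<Rightarrow> bool" for m :: nat where
  rel: "\<lbrakk>braid_relation r s; x @ r @ y \<in> braid_words m; x @ s @ y \<in> braid_words m\<rbrakk>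
          \<Longrightarrow> braid_equiv m (x @ r @ y) (x @ s @ y)"
| refl: "x \<in> braid_words m \<Longrightarrow> braid_equiv m x x"
| sym: "braid_equiv m x y \<Longrightarrow> braid_equiv m y x"
| trans: "\<lbrakk>braid_equiv m x y; braid_equiv m y z\<rbrakk> \<Longrightarrow> braid_equiv m x z"

definition braid_cong :: "nat \<Rightarrow> (braid_letter list \<times> braid_letter list) set" where
  "braid_cong m = {(x, y). braid_equiv m x y}"

definition braid_class :: "nat \<Rightarrow> braid_letter list \<Rightarrow> braid_letter list set" where
  "braid_class m x = braid_cong m `` {x}"

definition braid_group :: "nat \<Rightarrow> braid_letter list set monoid" where
  "braid_group m =
     \<lparr>carrier = braid_words m // braid_cong m,
      monoid.mult = (\<lambda>X Y. \<Union>x\<in>X. \<Union>y\<in>Y. braid_class m (x @ y)),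
      one = braid_class m []\<rparr>"

lemma braid_words_append [simp]:
  "x @ y \<in> braid_words m \<longleftrightarrow> x \<in> braid_words m \<and> y \<in> braid_words m"
  by (auto simp: braid_words_def)

lemma braid_equiv_words: "braid_equiv m x y \<Longrightarrow> x \<in> braid_words m \<and> y \<in> braid_words m"
  by (induction rule: braid_equiv.induct) auto

lemma braid_equiv_context:
  "braid_equiv m x y \<Longrightarrow> u \<in> braid_words m \<Longrightarrow> z \<in> braid_words m
     \<Longrightarrow> braid_equiv m (u @ x @ z) (u @ y @ z)"
proof (induction rule: braid_equiv.induct)
  case (rel r s x y)
  then show ?case using braid_equiv.rel[of r s "u @ x" "y @ z" m] by simp
next
  case (refl x)
  then show ?case by (simp add: braid_equiv.refl)
next
  case (sym x y)
  then show ?case by (simp add: braid_equiv.sym)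
next
  case (trans x y y')
  then show ?case by (meson braid_equiv.trans)
qed

lemma braid_equiv_append:
  assumes "braid_equiv m x x'" "braid_equiv m y y'"
  shows "braid_equiv m (x @ y) (x' @ y')"
proof -
  have "[] \<in> braid_words m" by (simp add: braid_words_def)
  then show ?thesis
    using braid_equiv_context[OF assms(1), of "[]" y] braid_equiv_context[OF assms(2), of x' "[]"]
      braid_equiv_words[OF assms(1)] braid_equiv_words[OF assms(2)]
    by simp (meson braid_equiv.trans)
qed

lemma equiv_braid_cong: "equiv (braid_words m) (braid_cong m)"
proof (rule equivI)
  show "braid_cong m \<subseteq> braid_words m \<times> braid_words m"
    by (auto simp: braid_cong_def dest: braid_equiv_words)
  show "refl_on (braid_words m) (braid_cong m)"
    by (simp add: refl_on_def braid_cong_def braid_equiv.refl)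
  show "sym (braid_cong m)"
    unfolding sym_def braid_cong_def by (blast dest: braid_equiv.sym)
  show "trans (braid_cong m)"
    unfolding trans_def braid_cong_def by (blast dest: braid_equiv.trans)
qed

lemma mem_braid_class: "y \<in> braid_class m x \<longleftrightarrow> braid_equiv m x y"
  by (simp add: braid_class_def braid_cong_def)

lemma braid_class_eq: "braid_equiv m x y \<Longrightarrow> braid_class m x = braid_class m y"
  unfolding set_eq_iff mem_braid_class by (meson braid_equiv.sym braid_equiv.trans)

lemma carrier_braid_group: "carrier (braid_group m) = braid_class m ` braid_words m"
  by (auto simp: braid_group_def braid_class_def quotient_def)

lemma braid_mult_class:
  assumes "x \<in> braid_words m" "y \<in> braid_words m"
  shows "braid_class m x \<otimes>\<^bsub>braid_group m\<^esub> braid_class m y = braid_class m (x @ y)"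
proof -
  have eq: "braid_class m (x' @ y') = braid_class m (x @ y)"
    if "x' \<in> braid_class m x" "y' \<in> braid_class m y" for x' y'
    by (rule braid_class_eq[symmetric], rule braid_equiv_append)
      (use that in \<open>simp_all add: mem_braid_class\<close>)
  have "x \<in> braid_class m x" "y \<in> braid_class m y"
    using assms by (simp_all add: mem_braid_class braid_equiv.refl)
  then have "(\<Union>x'\<in>braid_class m x. \<Union>y'\<in>braid_class m y. braid_class m (x' @ y'))
      = braid_class m (x @ y)"
    using eq by blast
  then show ?thesis by (simp add: braid_group_def)
qed

fun inv_letter :: "braid_letter \<Rightarrow> braid_letter" where
  "inv_letter (Gen i) = GenInv i"
| "inv_letter (GenInv i) = Gen i"

lemma gen_index_inv_letter [simp]: "gen_index (inv_letter x) = gen_index x"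
  by (cases x) auto

lemma braid_inverse_word:
  "x \<in> braid_words m \<Longrightarrow> braid_equiv m (rev (map inv_letter x) @ x) []"
proof (induction x)
  case Nil
  then show ?case by (simp add: braid_equiv.refl)
next
  case (Cons a x)
  let ?r = "rev (map inv_letter x)"
  have w: "?r \<in> braid_words m" "x \<in> braid_words m" "[inv_letter a, a] \<in> braid_words m"
    using Cons.prems by (auto simp: braid_words_def)
  have "braid_relation [inv_letter a, a] []"
    by (cases a) (auto intro: braid_relation.intros)
  then have "braid_equiv m (?r @ [inv_letter a, a] @ x) (?r @ [] @ x)"
    using w by (intro braid_equiv.rel) (auto simp: braid_words_def)
  then have "braid_equiv m (rev (map inv_letter (a # x)) @ a # x) (?r @ x)" by simp
  then show ?case using Cons.IH[OF w(2)] by (rule braid_equiv.trans)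
qed

lemma group_braid_group: "group (braid_group m)"
proof (rule groupI)
  have nil: "[] \<in> braid_words m" by (simp add: braid_words_def)
  have one: "\<one>\<^bsub>braid_group m\<^esub> = braid_class m []" by (simp add: braid_group_def)
  show "\<one>\<^bsub>braid_group m\<^esub> \<in> carrier (braid_group m)"
    using nil by (simp add: one carrier_braid_group)
  fix X assume "X \<in> carrier (braid_group m)"
  then obtain x where x: "x \<in> braid_words m" "X = braid_class m x"
    by (auto simp: carrier_braid_group)
  show "\<one>\<^bsub>braid_group m\<^esub> \<otimes>\<^bsub>braid_group m\<^esub> X = X"
    using x nil by (simp add: one braid_mult_class)
  let ?r = "rev (map inv_letter x)"
  have "?r \<in> braid_words m" using x by (auto simp: braid_words_def)
  then show "\<exists>Y\<in>carrier (braid_group m). Y \<otimes>\<^bsub>braid_group m\<^esub> X = \<one>\<^bsub>braid_group m\<^esub>"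
    using x braid_class_eq[OF braid_inverse_word[OF x(1)]]
    by (intro bexI[of _ "braid_class m ?r"]) (auto simp: one braid_mult_class carrier_braid_group)
qed (auto simp: carrier_braid_group braid_mult_class)

section \<open>The permutation of a braid and pure braids\<close>

text \<open>Words are read from top to bottom, so the letter at the head moves the top point first.\<close>

fun word_perm :: "braid_letter list \<Rightarrow> nat \<Rightarrow> nat" where
  "word_perm [] = id"
| "word_perm (x # w) = word_perm w \<circ> transpose (gen_index x) (gen_index x + 1)"

text \<open>Every word representing the braid yields the same value (see \<open>braid_perm_class\<close> and
  \<open>hurwitz_class\<close>), so that \<open>the_elem\<close> is applied to singletons.\<close>

definition braid_perm :: "braid_letter list set \<Rightarrow> nat \<Rightarrow> nat" where
  "braid_perm \<beta> = the_elem (word_perm ` \<beta>)"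

definition pure_braid_group :: "nat \<Rightarrow> braid_letter list set set" where
  "pure_braid_group m = {\<beta> \<in> carrier (braid_group m). braid_perm \<beta> = id}"

lemma word_perm_append: "word_perm (x @ y) = word_perm y \<circ> word_perm x"
  by (induction x) auto

lemma word_perm_equiv: "braid_equiv m x y \<Longrightarrow> word_perm x = word_perm y"
proof (induction rule: braid_equiv.induct)
  case (rel r s x y)
  have "word_perm r = word_perm s"
    using rel(1) by cases (auto simp: fun_eq_iff transpose_def)
  then show ?case by (simp add: word_perm_append)
qed auto

lemma braid_perm_class:
  assumes "x \<in> braid_words m"
  shows "braid_perm (braid_class m x) = word_perm x"
proof -
  have "x \<in> braid_class m x"
    unfolding mem_braid_class using assms(1) by (rule braid_equiv.refl)
  moreover have "word_perm y = word_perm x" if "y \<in> braid_class m x" for y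
    using that unfolding mem_braid_class by (rule word_perm_equiv[symmetric])
  ultimately have "word_perm ` braid_class m x = {word_perm x}" by blast
  then show ?thesis by (simp add: braid_perm_def)
qed

section \<open>The Hurwitz action on powers of the universal dihedral quandle\<close>

definition dihedral_op :: "int \<Rightarrow> int \<Rightarrow> int" where
  "dihedral_op a b = 2 * b - a"

text \<open>The tuple \<open>(a\<^sub>1, \<dots>, a\<^sub>m)\<close> is a list \<open>v\<close> of length \<open>m\<close> with
  \<open>a\<^sub>i = v ! (i - 1)\<close>.\<close>

fun letter_act :: "int list \<Rightarrow> braid_letter \<Rightarrow> int list" where
  "letter_act v (Gen i) = v[i - 1 := v ! i, i := dihedral_op (v ! (i - 1)) (v ! i)]"
| "letter_act v (GenInv i) = v[i - 1 := dihedral_op (v ! i) (v ! (i - 1)), i := v ! (i - 1)]"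

definition word_act :: "int list \<Rightarrow> braid_letter list \<Rightarrow> int list" where
  "word_act v w = foldl letter_act v w"

definition hurwitz :: "int list \<Rightarrow> braid_letter list set \<Rightarrow> int list" where
  "hurwitz v \<beta> = the_elem (word_act v ` \<beta>)"

lemma length_letter_act [simp]: "length (letter_act v x) = length v"
  by (cases x) auto

lemma length_word_act [simp]: "length (word_act v w) = length v"
  unfolding word_act_def by (induction w arbitrary: v) auto

lemma word_act_append: "word_act v (x @ y) = word_act (word_act v x) y"
  by (simp add: word_act_def)

lemma word_act_relation:
  assumes "braid_relation r s" "r \<in> braid_words m" "s \<in> braid_words m" "length v = m"
  shows "word_act v r = word_act v s"
  using assms(1)
proof cases
  case (inv_right i)
  then obtain k where k: "i = Suc k" "Suc k < length v"
    using assms(2,4) by (cases i) (auto simp: braid_words_def)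
  show ?thesis
    unfolding inv_right using k
    by (simp add: word_act_def dihedral_op_def list_update_swap[of k "Suc k"])
next
  case (inv_left i)
  then obtain k where k: "i = Suc k" "Suc k < length v"
    using assms(2,4) by (cases i) (auto simp: braid_words_def)
  show ?thesis
    unfolding inv_left using k
    by (simp add: word_act_def dihedral_op_def list_update_swap[of k "Suc k"])
next
  case (far_comm i j)
  then obtain k l where kl: "i = Suc k" "j = Suc l" "k + 2 \<le> l \<or> l + 2 \<le> k"
    "Suc k < length v" "Suc l < length v"
    using assms(2,4) by (cases i; cases j) (auto simp: braid_words_def)
  have ne: "l \<noteq> k" "l \<noteq> Suc k" "k \<noteq> Suc l" using kl(3) by auto
  have swap: "v[k := a, Suc k := b, l := c, Suc l := e] = v[l := c, Suc l := e, k := a, Suc k := b]"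
    for a b c e using ne kl(4,5) by (auto simp: nth_list_update intro!: nth_equalityI)
  show ?thesis
    unfolding far_comm using kl(1,2,4,5) ne not_sym[OF ne(1)] not_sym[OF ne(2)] not_sym[OF ne(3)]
    by (simp add: word_act_def swap)
next
  case (braid i)
  then obtain k where k: "i = Suc k" "Suc (Suc k) < length v"
    using assms(2,4) by (cases i) (auto simp: braid_words_def)
  define T where "T x y z = v[k := x, Suc k := y, Suc (Suc k) := z]" for x y z
  have 1: "letter_act (T x y z) (Gen (Suc k)) = T y (dihedral_op x y) z" for x y z
    using k by (auto simp: T_def nth_list_update intro!: nth_equalityI)
  have 2: "letter_act (T x y z) (Gen (Suc (Suc k))) = T x z (dihedral_op y z)" for x y z
    using k by (auto simp: T_def nth_list_update intro!: nth_equalityI)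
  have "v = T (v ! k) (v ! Suc k) (v ! Suc (Suc k))"
    by (simp add: T_def)
  then obtain x y z where v: "v = T x y z" by blast
  have "word_act (T x y z) r = word_act (T x y z) s"
    unfolding braid k(1) word_act_def Suc_eq_plus1[symmetric] foldl.simps 1 2
    by (simp add: dihedral_op_def algebra_simps)
  then show ?thesis using v by simp
qed

lemma word_act_equiv: "braid_equiv m x y \<Longrightarrow> length v = m \<Longrightarrow> word_act v x = word_act v y"
proof (induction rule: braid_equiv.induct)
  case (rel r s x y)
  then have "word_act (word_act v x) r = word_act (word_act v x) s"
    by (intro word_act_relation[where m = m]) auto
  then show ?case by (simp add: word_act_append)
qed auto

lemma hurwitz_class:
  assumes "x \<in> braid_words m" "length v = m"
  shows "hurwitz v (braid_class m x) = word_act v x"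
proof -
  have "x \<in> braid_class m x"
    unfolding mem_braid_class using assms(1) by (rule braid_equiv.refl)
  moreover have "word_act v y = word_act v x" if "y \<in> braid_class m x" for y
    using word_act_equiv[of m x y v] that assms(2) by (simp add: mem_braid_class)
  ultimately have "word_act v ` braid_class m x = {word_act v x}" by blast
  then show ?thesis by (simp add: hurwitz_def)
qed

lemma hurwitz_one: "length v = m \<Longrightarrow> hurwitz v \<one>\<^bsub>braid_group m\<^esub> = v"
  using hurwitz_class[of "[]" m v] by (simp add: braid_group_def braid_words_def word_act_def)

lemma hurwitz_mult:
  assumes "length v = m" "\<beta> \<in> carrier (braid_group m)" "\<gamma> \<in> carrier (braid_group m)"
  shows "hurwitz v (\<beta> \<otimes>\<^bsub>braid_group m\<^esub> \<gamma>) = hurwitz (hurwitz v \<beta>) \<gamma>"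
  using assms
  by (auto simp: carrier_braid_group braid_mult_class hurwitz_class word_act_append)

lemma hurwitz_generator:
  assumes "length xs = i - 1" "1 \<le> i" "length (xs @ [a, b] @ ys) = m"
  shows "hurwitz (xs @ [a, b] @ ys) (braid_class m [Gen i]) = xs @ [b, 2 * b - a] @ ys"
proof -
  have w: "[Gen i] \<in> braid_words m" using assms by (simp add: braid_words_def)
  have i: "i = Suc (length xs)" using assms(1,2) by simp
  have "letter_act (xs @ [a, b] @ ys) (Gen i) = xs @ [b, 2 * b - a] @ ys"
    unfolding i letter_act.simps
    by (simp add: dihedral_op_def nth_append list_update_append)
  then show ?thesis
    unfolding hurwitz_class[OF w assms(3)] by (simp add: word_act_def)
qed

section \<open>Invariants\<close>

definition trivial_tuple :: "int list \<Rightarrow> bool" where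
  "trivial_tuple v \<longleftrightarrow> (\<forall>i < length v. \<forall>j < length v. v ! i = v ! j)"

text \<open>The exponent \<open>i - 1\<close> of the sign becomes \<open>i\<close> as lists are indexed from \<open>0\<close>.\<close>

definition Delta :: "int list \<Rightarrow> int" where
  "Delta v = (\<Sum>i<length v. (-1) ^ i * v ! i)"

definition diff_gcd :: "int list \<Rightarrow> int" where
  "diff_gcd v = (if trivial_tuple v then 0
     else Gcd {v ! i - v ! j | i j. i < length v \<and> j < length v})"

text \<open>For modulus \<open>0\<close> the congruence class of \<open>a\<close> is \<open>{a}\<close>, which stands for the integer \<open>a\<close>.\<close>

definition cong_class :: "int \<Rightarrow> int \<Rightarrow> int set" where
  "cong_class n a = {b. [b = a] (mod n)}"

definition M_star :: "int list \<Rightarrow> int set list" where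
  "M_star v = map (cong_class (2 * diff_gcd v)) v"

end

theory Submission imports Defs
begin

text \<open>For the hard direction one may assume by an affine change of variable that \<open>d = 1\<close>, so that
  \<open>M\<^sup>*\<close> records parities, and argue by induction on \<open>m\<close>. For \<open>m \<ge> 3\<close> two entries have equal
  parity and can be moved to the front; a Euclidean descent on their difference, using a third entry,
  makes them equal. An equal pair \<open>(a, a)\<close> can be reflected in any other entry \<open>c\<close>, becoming
  \<open>(2 c - a, 2 c - a)\<close>, with nothing else changed. For \<open>m \<ge> 4\<close> the induction hypothesis, applied to
  one \<open>a\<close> together with the remaining entries, makes one of these equal to \<open>a \<plusminus> 1\<close>, and
  reflecting in it shifts the pair by \<open>\<plusminus> 2\<close>. So the pair can be given any value of the right
  parity, and the induction hypothesis adjusts the rest.\<close>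

section \<open>Invariants of the Hurwitz action\<close>

lemma Delta_Nil [simp]: "Delta [] = 0"
  by (simp add: Delta_def)

lemma Delta_Cons [simp]: "Delta (a # v) = a - Delta v"
  by (simp add: Delta_def sum.lessThan_Suc_shift sum_negf del: sum.lessThan_Suc)

lemma Delta_append: "Delta (u @ v) = Delta u + (-1) ^ length u * Delta v"
  by (induction u) (auto simp: algebra_simps)

lemma Delta_list_update:
  "i < length v \<Longrightarrow> Delta (v[i := x]) = Delta v + (-1) ^ i * (x - v ! i)"
proof (induction v arbitrary: i)
  case (Cons a v)
  then show ?case by (cases i) (auto simp: algebra_simps)
qed simp

text \<open>The added constants cancel in pairs in the alternating sum, so one of them survives
  exactly for odd length.\<close>

lemma Delta_affine:
  "Delta (map (\<lambda>x. d * x + c) v) = d * Delta v + (if odd (length v) then c else 0)"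
  by (induction v) (auto simp: algebra_simps)

text \<open>All differences of a trivial tuple vanish, so their \<open>Gcd\<close> is 0 as well.
  Ranging over entries instead of positions makes the order of the entries immaterial.\<close>

lemma diff_gcd_eq_Gcd: "diff_gcd v = Gcd {x - y | x y. x \<in> set v \<and> y \<in> set v}"
proof -
  have eq: "{v ! i - v ! j | i j. i < length v \<and> j < length v} = {x - y | x y. x \<in> set v \<and> y \<in> set v}"
    by (auto simp: in_set_conv_nth)
  have "Gcd {x - y | x y. x \<in> set v \<and> y \<in> set v} = 0" if triv: "trivial_tuple v"
  proof -
    have "x = y" if "x \<in> set v" "y \<in> set v" for x y
      using triv that unfolding trivial_tuple_def in_set_conv_nth by metis
    then show ?thesis unfolding Gcd_0_iff by auto
  qed
  then show ?thesis by (simp add: diff_gcd_def eq)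
qed

lemma diff_gcd_nonneg: "diff_gcd v \<ge> 0"
  by (simp add: diff_gcd_eq_Gcd)

lemma dvd_diff_gcd_iff:
  "e dvd diff_gcd v \<longleftrightarrow> (\<forall>x\<in>set v. \<forall>y\<in>set v. e dvd x - y)"
  by (auto simp: diff_gcd_eq_Gcd dvd_Gcd_iff)

text \<open>Every difference is a difference of two differences to the base entry
  \<open>c\<close>.\<close>

lemma dvd_diff_gcd_iff_base:
  assumes "c \<in> set v"
  shows "e dvd diff_gcd v \<longleftrightarrow> (\<forall>x\<in>set v. e dvd x - c)"
proof -
  have "e dvd x - y" if "e dvd x - c" "e dvd y - c" for x y
    using dvd_diff[OF that] by simp
  then show ?thesis using assms unfolding dvd_diff_gcd_iff by blast
qed

lemma diff_gcd_dvd_diff: "x \<in> set v \<Longrightarrow> y \<in> set v \<Longrightarrow> diff_gcd v dvd x - y"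
  using dvd_diff_gcd_iff[of "diff_gcd v" v] by simp

lemma diff_gcd_eqI:
  assumes "\<And>e. e dvd diff_gcd v \<longleftrightarrow> e dvd diff_gcd w"
  shows "diff_gcd v = diff_gcd w"
  using assms diff_gcd_nonneg by (meson dvd_refl zdvd_antisym_nonneg)

lemma diff_gcd_eq_1I:
  assumes "x \<in> set v" "y \<in> set v" "\<bar>x - y\<bar> = 1"
  shows "diff_gcd v = 1"
proof -
  have "diff_gcd v dvd 1"
    using diff_gcd_dvd_diff[OF assms(1,2)] assms(3) by (metis dvd_abs_iff)
  then show ?thesis using diff_gcd_nonneg[of v] by simp
qed

section \<open>Effect of one letter, then of a word, on the invariants\<close>

lemma letter_act_Gen [simp]:
  "letter_act (xs @ a # b # ys) (Gen (Suc (length xs))) = xs @ b # (2 * b - a) # ys"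
  by (simp add: dihedral_op_def nth_append list_update_append)

lemma letter_act_GenInv [simp]:
  "letter_act (xs @ a # b # ys) (GenInv (Suc (length xs))) = xs @ (2 * a - b) # a # ys"
  by (simp add: dihedral_op_def nth_append list_update_append)

lemma letter_act_split:
  assumes "[g] \<in> braid_words (length v)"
  obtains xs a b ys where "v = xs @ a # b # ys" "gen_index g = Suc (length xs)"
    "letter_act v g = xs @ b # (2 * b - a) # ys \<or> letter_act v g = xs @ (2 * a - b) # a # ys"
proof -
  obtain k where k: "gen_index g = Suc k" "Suc k < length v"
    using assms by (cases "gen_index g") (auto simp: braid_words_def)
  define xs where "xs = take k v"
  have xs: "length xs = k" using k by (simp add: xs_def)
  have v: "v = xs @ v ! k # v ! Suc k # drop (Suc (Suc k)) v"
    using k by (simp add: xs_def Cons_nth_drop_Suc)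
  show ?thesis
  proof (rule that[OF v])
    show "gen_index g = Suc (length xs)" using k xs by simp
    show "letter_act v g = xs @ v ! Suc k # (2 * v ! Suc k - v ! k) # drop (Suc (Suc k)) v \<or>
      letter_act v g = xs @ (2 * v ! k - v ! Suc k) # v ! k # drop (Suc (Suc k)) v"
      using k(1) letter_act_Gen[of xs "v ! k" "v ! Suc k" "drop (Suc (Suc k)) v"]
        letter_act_GenInv[of xs "v ! k" "v ! Suc k" "drop (Suc (Suc k)) v"]
      unfolding v[symmetric] xs by (cases g) auto
  qed
qed

lemma Delta_letter_act: "[g] \<in> braid_words (length v) \<Longrightarrow> Delta (letter_act v g) = Delta v"
  by (erule letter_act_split) (auto simp: Delta_append)

lemma diff_gcd_letter_act:
  assumes "[g] \<in> braid_words (length v)"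
  shows "diff_gcd (letter_act v g) = diff_gcd v"
proof (rule diff_gcd_eqI)
  fix e
  obtain xs a b ys where v: "v = xs @ a # b # ys"
    and g: "letter_act v g = xs @ b # (2 * b - a) # ys \<or> letter_act v g = xs @ (2 * a - b) # a # ys"
    using letter_act_split[OF assms] .
  \<comment> \<open>Reflection keeps the distance to the entry that stays unchanged. Taking that
    entry as base, the divisibility conditions before and after coincide.\<close>
  have "b - a = (2 * b - a) - b" "a - b = (2 * a - b) - a" by simp_all
  then show "e dvd diff_gcd (letter_act v g) \<longleftrightarrow> e dvd diff_gcd v"
    using g dvd_diff_gcd_iff_base[of b v e] dvd_diff_gcd_iff_base[of b "letter_act v g" e]
      dvd_diff_gcd_iff_base[of a v e] dvd_diff_gcd_iff_base[of a "letter_act v g" e]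
      dvd_diff_commute[of e a b]
    unfolding v by (elim disjE) (simp, blast?)+
qed

text \<open>The reflected entry changes by twice a difference of entries, hence by a multiple of
  \<open>2 * diff_gcd v\<close>; all others keep their value. Thus modulo \<open>e\<close> a letter
  only permutes the tuple. Permutations count positions from 1, lists from 0.\<close>

lemma letter_act_cong:
  assumes g: "[g] \<in> braid_words (length v)" and e: "e dvd 2 * diff_gcd v"
    and k: "1 \<le> k" "k \<le> length v"
  shows "e dvd letter_act v g ! (transpose (gen_index g) (gen_index g + 1) k - 1) - v ! (k - 1)"
proof -
  obtain xs a b ys where v: "v = xs @ a # b # ys" and i: "gen_index g = Suc (length xs)"
    and act: "letter_act v g = xs @ b # (2 * b - a) # ys \<or> letter_act v g = xs @ (2 * a - b) # a # ys"
    using letter_act_split[OF g] .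
  have "diff_gcd v dvd a - b" by (rule diff_gcd_dvd_diff) (auto simp: v)
  then have "e dvd 2 * (a - b)" using e by (meson dvd_trans mult_dvd_mono dvd_refl)
  then have d: "e dvd 2 * a - 2 * b" "e dvd 2 * b - 2 * a"
    by (simp_all add: right_diff_distrib dvd_diff_commute)
  obtain l where l: "k = Suc l" using k by (cases k) auto
  consider "l = length xs" | "l = Suc (length xs)" | "l \<noteq> length xs" "l \<noteq> Suc (length xs)" by blast
  then show ?thesis
  proof cases
    case 3
    then have "letter_act v g ! l = v ! l"
      using act by (auto simp: v nth_append nth_Cons split: nat.splits)
    then show ?thesis using 3 by (simp add: i l transpose_def)
  qed (use act d in \<open>auto simp: i l v nth_append transpose_def\<close>)
qed

lemma braid_words_Cons [simp]:
  "g # x \<in> braid_words m \<longleftrightarrow> 1 \<le> gen_index g \<and> gen_index g < m \<and> x \<in> braid_words m"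
  by (auto simp: braid_words_def)

lemma braid_words_Nil [simp]: "[] \<in> braid_words m"
  by (simp add: braid_words_def)

lemma word_act_Nil [simp]: "word_act v [] = v"
  by (simp add: word_act_def)

lemma word_act_Cons [simp]: "word_act v (g # x) = word_act (letter_act v g) x"
  by (simp add: word_act_def)

lemma Delta_word_act: "x \<in> braid_words (length v) \<Longrightarrow> Delta (word_act v x) = Delta v"
  by (induction x arbitrary: v) (auto simp: Delta_letter_act)

lemma diff_gcd_word_act: "x \<in> braid_words (length v) \<Longrightarrow> diff_gcd (word_act v x) = diff_gcd v"
  by (induction x arbitrary: v) (auto simp: diff_gcd_letter_act)

text \<open>Keeping track of \<open>word_perm\<close> lets the induction pass through prefixes of a
  pure word that are not pure.\<close>

lemma word_act_cong:
  assumes "x \<in> braid_words (length v)" "e dvd 2 * diff_gcd v" "1 \<le> k" "k \<le> length v"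
  shows "e dvd word_act v x ! (word_perm x k - 1) - v ! (k - 1)"
  using assms
proof (induction x arbitrary: v k)
  case (Cons g x)
  define l where "l = transpose (gen_index g) (gen_index g + 1) k"
  have g: "[g] \<in> braid_words (length v)" and x: "x \<in> braid_words (length v)"
    using Cons.prems by simp_all
  have l: "1 \<le> l" "l \<le> length v"
    using g Cons.prems by (auto simp: l_def transpose_def braid_words_def)
  have 1: "e dvd word_act (letter_act v g) x ! (word_perm x l - 1) - letter_act v g ! (l - 1)"
    by (rule Cons.IH) (use x g l Cons.prems in \<open>simp_all add: diff_gcd_letter_act\<close>)
  have 2: "e dvd letter_act v g ! (l - 1) - v ! (k - 1)"
    unfolding l_def using g Cons.prems by (intro letter_act_cong) auto
  have "e dvd word_act (letter_act v g) x ! (word_perm x l - 1) - v ! (k - 1)"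
    using dvd_add[OF 1 2] by simp
  then show ?case by (simp add: l_def)
qed simp

text \<open>Since \<open>2 * b - a\<close> has the parity of \<open>a\<close>, a braid permutes the
  parity pattern in a way that depends on the braid alone. This allows one braid, not necessarily
  pure, to prepare both tuples at once.\<close>

lemma map_even_word_act:
  assumes "x \<in> braid_words (length v)" "map even v = map even w"
  shows "map even (word_act v x) = map even (word_act w x)"
  using assms
proof (induction x arbitrary: v w)
  case (Cons g x)
  have len: "length v = length w" using Cons.prems(2) map_eq_imp_length_eq by blast
  have nth: "even (v ! i) = even (w ! i)" if "i < length w" for i
    using Cons.prems(2) len that by (metis nth_map)
  have "1 \<le> gen_index g" "gen_index g < length w"
    using Cons.prems(1) len by (auto simp: braid_words_def)
  then have "map even (letter_act v g) = map even (letter_act w g)"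
    using len nth by (cases g) (auto simp: nth_list_update dihedral_op_def intro!: nth_equalityI)
  then show ?case
    using Cons.IH[of "letter_act v g" "letter_act w g"] Cons.prems(1) by simp
qed simp

section \<open>Equivalence under pure braids\<close>

text \<open>The orbit relation of the pure braid group on the level of words, with the number of
  strands read off from the tuple.\<close>

definition pure_equiv :: "int list \<Rightarrow> int list \<Rightarrow> bool" where
  "pure_equiv v w \<longleftrightarrow> (\<exists>x\<in>braid_words (length v). word_perm x = id \<and> word_act v x = w)"

lemma pure_equivI:
  "x \<in> braid_words (length v) \<Longrightarrow> word_perm x = id \<Longrightarrow> word_act v x = w \<Longrightarrow> pure_equiv v w"
  by (auto simp: pure_equiv_def)

lemma ex_pure_braid_iff:
  assumes "length v = m"
  shows "(\<exists>\<beta>\<in>pure_braid_group m. hurwitz v \<beta> = w) \<longleftrightarrow> pure_equiv v w"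
proof -
  have "pure_braid_group m = braid_class m ` {x \<in> braid_words m. word_perm x = id}"
    by (auto simp: pure_braid_group_def carrier_braid_group braid_perm_class)
  then show ?thesis using assms by (auto simp: pure_equiv_def hurwitz_class)
qed

lemma pure_equiv_invariants:
  assumes "pure_equiv v w"
  shows "length w = length v" "Delta w = Delta v" "diff_gcd w = diff_gcd v"
    and "i < length v \<Longrightarrow> 2 * diff_gcd v dvd w ! i - v ! i"
proof -
  obtain x where x: "x \<in> braid_words (length v)" "word_perm x = id" "word_act v x = w"
    using assms by (auto simp: pure_equiv_def)
  show "length w = length v" "Delta w = Delta v" "diff_gcd w = diff_gcd v"
    using Delta_word_act[OF x(1)] diff_gcd_word_act[OF x(1)] by (simp_all add: x(3)[symmetric])
  show "2 * diff_gcd v dvd w ! i - v ! i" if "i < length v"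
    using word_act_cong[OF x(1), of "2 * diff_gcd v" "Suc i"] x that by simp
qed

lemma pure_equiv_map_even:
  assumes "pure_equiv v w"
  shows "map even w = map even v"
proof (rule nth_equalityI)
  fix i assume "i < length (map even w)"
  then have i: "i < length v" by (simp add: pure_equiv_invariants(1)[OF assms])
  have "even (w ! i - v ! i)"
    using pure_equiv_invariants(4)[OF assms i] by (rule dvd_mult_left)
  then show "map even w ! i = map even v ! i"
    using i by (simp add: pure_equiv_invariants(1)[OF assms])
qed (simp add: pure_equiv_invariants(1)[OF assms])

lemma pure_equiv_refl: "pure_equiv v v"
  by (rule pure_equivI[of "[]"]) auto

lemma pure_equiv_trans [trans]: "pure_equiv u v \<Longrightarrow> pure_equiv v w \<Longrightarrow> pure_equiv u w"
proof -
  assume "pure_equiv u v" "pure_equiv v w"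
  then obtain x y where
    "x \<in> braid_words (length u)" "word_perm x = id" "word_act u x = v"
    "y \<in> braid_words (length u)" "word_perm y = id" "word_act v y = w"
    by (auto simp: pure_equiv_def)
  then show "pure_equiv u w"
    by (intro pure_equivI[of "x @ y"]) (auto simp: word_perm_append word_act_append)
qed

lemma braid_word_inverse:
  assumes "x \<in> braid_words m"
  obtains y where "y \<in> braid_words m" "braid_equiv m (x @ y) []" "braid_equiv m (y @ x) []"
proof -
  have "rev (map inv_letter x) \<in> braid_words m"
    using assms by (auto simp: braid_words_def)
  moreover have "inv_letter (inv_letter g) = g" for g by (cases g) auto
  then have "rev (map inv_letter (rev (map inv_letter x))) = x"
    by (simp add: rev_map[symmetric] o_def)
  ultimately show ?thesis
    using that braid_inverse_word assms by metis
qed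

lemma pure_equiv_sym:
  assumes "pure_equiv v w"
  shows "pure_equiv w v"
proof -
  obtain x where x: "x \<in> braid_words (length v)" "word_perm x = id" "word_act v x = w"
    using assms by (auto simp: pure_equiv_def)
  obtain y where y: "y \<in> braid_words (length v)" "braid_equiv (length v) (x @ y) []"
    using braid_word_inverse[OF x(1)] by metis
  show ?thesis
  proof (rule pure_equivI)
    show "y \<in> braid_words (length w)" using x y by auto
    show "word_perm y = id" using word_perm_equiv[OF y(2)] x by (simp add: word_perm_append)
    show "word_act w y = v" using word_act_equiv[OF y(2), of v] x by (simp add: word_act_append)
  qed
qed

text \<open>Pure braids are closed under conjugation: if \<open>p\<close> is pure and
  \<open>y\<close> inverts \<open>x\<close>, then \<open>x @ p @ y\<close> is pure. Hence both
  tuples may first be rearranged by the same arbitrary braid.\<close>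

lemma pure_equiv_conjugate:
  assumes x: "x \<in> braid_words (length v)" and len: "length w = length v"
    and "pure_equiv (word_act v x) (word_act w x)"
  shows "pure_equiv v w"
proof -
  obtain p where p: "p \<in> braid_words (length v)" "word_perm p = id"
    "word_act (word_act v x) p = word_act w x"
    using assms(3) by (auto simp: pure_equiv_def)
  obtain y where y: "y \<in> braid_words (length v)" "braid_equiv (length v) (x @ y) []"
    using braid_word_inverse[OF x] by metis
  show ?thesis
  proof (rule pure_equivI)
    show "x @ p @ y \<in> braid_words (length v)" using x p y by simp
    show "word_perm (x @ p @ y) = id"
      using word_perm_equiv[OF y(2)] p by (simp add: word_perm_append)
    show "word_act v (x @ p @ y) = w"
      using word_act_equiv[OF y(2), of w] p len by (simp add: word_act_append)
  qed
qed

section \<open>Adding a strand on the left, twists and reflections\<close>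

fun shift_letter :: "braid_letter \<Rightarrow> braid_letter" where
  "shift_letter (Gen i) = Gen (Suc i)"
| "shift_letter (GenInv i) = GenInv (Suc i)"

lemma gen_index_shift_letter [simp]: "gen_index (shift_letter g) = Suc (gen_index g)"
  by (cases g) auto

lemma braid_words_map_shift [intro]:
  "x \<in> braid_words m \<Longrightarrow> map shift_letter x \<in> braid_words (Suc m)"
  by (auto simp: braid_words_def)

lemma word_perm_map_shift:
  "word_perm (map shift_letter x) k = (case k of 0 \<Rightarrow> 0 | Suc l \<Rightarrow> Suc (word_perm x l))"
  by (induction x arbitrary: k) (auto simp: transpose_def split: nat.splits)

lemma word_act_map_shift:
  "x \<in> braid_words m \<Longrightarrow> word_act (a # v) (map shift_letter x) = a # word_act v x"
proof (induction x arbitrary: v)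
  case (Cons g x)
  then obtain i where "gen_index g = Suc i"
    by (cases "gen_index g") (auto simp: braid_words_def)
  then have "letter_act (a # v) (shift_letter g) = a # letter_act v g"
    by (cases g) auto
  then show ?case using Cons by simp
qed simp

lemma pure_equiv_Cons:
  assumes "pure_equiv v w"
  shows "pure_equiv (a # v) (a # w)"
proof -
  obtain x where x: "x \<in> braid_words (length v)" "word_perm x = id" "word_act v x = w"
    using assms by (auto simp: pure_equiv_def)
  show ?thesis
  proof (rule pure_equivI)
    show "map shift_letter x \<in> braid_words (length (a # v))" using x(1) by auto
    show "word_perm (map shift_letter x) = id"
      by (auto simp: fun_eq_iff word_perm_map_shift x(2) split: nat.splits)
    show "word_act (a # v) (map shift_letter x) = a # w"
      using x by (simp add: word_act_map_shift)
  qed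
qed

text \<open>The full twist of the first two strands adds \<open>2 * (b - a)\<close> to both entries
  and preserves their difference, so it can be iterated; negative \<open>k\<close> follows by
  symmetry.\<close>

lemma pure_equiv_twist:
  "pure_equiv (a # b # r) ((a + 2 * k * (b - a)) # (b + 2 * k * (b - a)) # r)"
proof -
  have 1: "pure_equiv (a # b # r) ((a + 2 * (b - a)) # (b + 2 * (b - a)) # r)" for a b
    by (rule pure_equivI[of "[Gen 1, Gen 1]"])
      (auto simp: braid_words_def dihedral_op_def)
  have nat: "pure_equiv (a # b # r) ((a + 2 * int n * (b - a)) # (b + 2 * int n * (b - a)) # r)" for a b n
  proof (induction n)
    case 0
    then show ?case by (simp add: pure_equiv_refl)
  next
    case (Suc n)
    have "pure_equiv ((a + 2 * int n * (b - a)) # (b + 2 * int n * (b - a)) # r)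
      ((a + 2 * int (Suc n) * (b - a)) # (b + 2 * int (Suc n) * (b - a)) # r)"
      using 1[of "a + 2 * int n * (b - a)" "b + 2 * int n * (b - a)"]
      by (simp add: algebra_simps)
    with Suc show ?case by (rule pure_equiv_trans)
  qed
  show ?thesis
  proof (cases "k \<ge> 0")
    case True
    then show ?thesis using nat[of a b "nat k"] by simp
  next
    case False
    then show ?thesis
      using pure_equiv_sym[OF nat[of "a + 2 * k * (b - a)" "b + 2 * k * (b - a)" "nat (- k)"]]
      by (simp add: algebra_simps)
  qed
qed

text \<open>A positive generator moves the right one of two neighbours to the left unchanged, so
  \<open>c\<close> keeps its value while the entries it passes are reflected.\<close>

lemma word_act_to_front:
  assumes "c \<in> set v"
  obtains x u where "x \<in> braid_words (length v)" "word_act v x = c # u"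
  using assms
proof (induction v arbitrary: thesis)
  case (Cons y v)
  show ?case
  proof (cases "c = y")
    case True
    then show ?thesis using Cons.prems(1)[of "[]" v] by simp
  next
    case False
    then have "c \<in> set v" using Cons.prems by simp
    then obtain x u where x: "x \<in> braid_words (length v)" "word_act v x = c # u"
      using Cons.IH by blast
    have "v \<noteq> []" using \<open>c \<in> set v\<close> by auto
    then have "map shift_letter x @ [Gen 1] \<in> braid_words (length (y # v))"
      using x(1) by (auto simp: braid_words_def)
    moreover have "word_act (y # v) (map shift_letter x @ [Gen 1]) = c # (2 * c - y) # u"
      using x by (simp add: word_act_append word_act_map_shift dihedral_op_def)
    ultimately show ?thesis using Cons.prems(1) by blast
  qed
qed simp

text \<open>An entry \<open>c\<close> is brought next to the first two by a braid that does not touch them; the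
  inverse of that braid restores the order of the strands.\<close>

lemma pure_equiv_with_entry:
  assumes "c \<in> set r"
  obtains u where
    "\<And>a b a' b' c'. pure_equiv (a # b # c # u) (a' # b' # c' # u) \<Longrightarrow>
       \<exists>r'. pure_equiv (a # b # r) (a' # b' # r') \<and> (c' = c \<longrightarrow> r' = r)"
proof -
  obtain x u where x: "x \<in> braid_words (length r)" "word_act r x = c # u"
    using word_act_to_front[OF assms] .
  obtain y where y: "y \<in> braid_words (length r)" "braid_equiv (length r) (x @ y) []"
    and yx: "braid_equiv (length r) (y @ x) []"
    using braid_word_inverse[OF x(1)] .
  have len: "length (c # u) = length r" using x(2) length_word_act by metis
  let ?x = "map shift_letter (map shift_letter x)"
  have act: "word_act (a # b # s) ?x = a # b # word_act s x" for a b s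
    using x(1) by (simp add: word_act_map_shift[of _ "Suc (length r)"] word_act_map_shift
        braid_words_map_shift del: map_map)
  show ?thesis
  proof (rule that)
    fix a b a' b' c'
    assume eq: "pure_equiv (a # b # c # u) (a' # b' # c' # u)"
    let ?r = "word_act (c' # u) y"
    have r: "word_act ?r x = c' # u"
      using word_act_equiv[OF yx, of "c' # u"] len by (simp add: word_act_append)
    have "pure_equiv (a # b # r) (a' # b' # ?r)"
    proof (rule pure_equiv_conjugate)
      show "?x \<in> braid_words (length (a # b # r))"
        unfolding list.size(4) add_Suc_right add_0_right by (intro braid_words_map_shift x(1))
      show "length (a' # b' # ?r) = length (a # b # r)" using len by simp
      show "pure_equiv (word_act (a # b # r) ?x) (word_act (a' # b' # ?r) ?x)"
        using eq unfolding act r x(2) .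
    qed
    moreover have "word_act (c # u) y = r"
      using word_act_equiv[OF y(2), of r] x(2) by (simp add: word_act_append)
    ultimately show "\<exists>r'. pure_equiv (a # b # r) (a' # b' # r') \<and> (c' = c \<longrightarrow> r' = r)"
      by blast
  qed
qed

text \<open>With \<open>c\<close> next to the pair, let \<open>c\<close> travel around it and back.
  Moving left it reflects both copies of \<open>a\<close>; on the way back it is reflected twice in
  the same value \<open>2 * c - a\<close> and so returns to \<open>c\<close>.\<close>

lemma pure_equiv_reflect_pair:
  assumes "c \<in> set r"
  shows "pure_equiv (a # a # r) ((2 * c - a) # (2 * c - a) # r)"
proof -
  have "pure_equiv (a # a # c # u) ((2 * c - a) # (2 * c - a) # c # u)" for u
    by (rule pure_equivI[of "[Gen 2, Gen 1, Gen 1, Gen 2]"])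
      (auto simp: braid_words_def dihedral_op_def fun_eq_iff transpose_def numeral_2_eq_2)
  then show ?thesis
    using pure_equiv_with_entry[OF assms] by metis
qed

section \<open>Tuples with coprime differences\<close>

lemma centered_remainder:
  fixes x y :: int
  assumes "x \<noteq> 0"
  obtains k where "\<bar>y - 2 * k * x\<bar> \<le> \<bar>x\<bar>"
proof -
  \<comment> \<open>Adding \<open>\<bar>x\<bar>\<close> before dividing by
    \<open>2 * \<bar>x\<bar>\<close> centres the remainder at 0.\<close>
  define q where "q = (y + \<bar>x\<bar>) div (2 * \<bar>x\<bar>)"
  have "y + \<bar>x\<bar> = 2 * \<bar>x\<bar> * q + (y + \<bar>x\<bar>) mod (2 * \<bar>x\<bar>)"
    by (simp add: q_def)
  moreover have "0 \<le> (y + \<bar>x\<bar>) mod (2 * \<bar>x\<bar>)" "(y + \<bar>x\<bar>) mod (2 * \<bar>x\<bar>) < 2 * \<bar>x\<bar>"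
    using assms by auto
  ultimately have "\<bar>y - 2 * \<bar>x\<bar> * q\<bar> \<le> \<bar>x\<bar>" by linarith
  then have "\<bar>y - 2 * (sgn x * q) * x\<bar> \<le> \<bar>x\<bar>"
    by (simp add: abs_sgn mult_ac)
  then show ?thesis using that by blast
qed

text \<open>In terms of the successive differences \<open>x = b - a\<close> and \<open>y = c - b\<close>, the twists of adjacent
  strands replace \<open>y\<close> by \<open>y - 2 k x\<close> or \<open>x\<close> by \<open>x + 2 k y\<close>.\<close>

lemma pure_equiv_shrink:
  fixes a b c :: int
  assumes "\<not> b - a dvd c - b" "b \<noteq> a"
  obtains a' b' c' where "pure_equiv (a # b # c # u) (a' # b' # c' # u)" "\<bar>b' - a'\<bar> < \<bar>b - a\<bar>"
proof -
  define x where "x = b - a"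
  obtain k where k: "\<bar>(c - b) - 2 * k * x\<bar> \<le> \<bar>x\<bar>"
    using centered_remainder[of x "c - b"] assms(2) by (auto simp: x_def)
  define y where "y = (c - b) - 2 * k * x"
  have "\<not> x dvd y"
  proof
    assume "x dvd y"
    then have "x dvd y + 2 * k * x" by simp
    then show False using assms(1) by (simp add: y_def x_def)
  qed
  then have y: "y \<noteq> 0" "\<bar>y\<bar> \<noteq> \<bar>x\<bar>" "\<bar>y\<bar> \<le> \<bar>x\<bar>"
    using k by (auto simp: y_def[symmetric] abs_eq_iff)
  \<comment> \<open>The sign makes \<open>2 * j * y\<close> point against \<open>x\<close>, so the
    new size is the absolute value of \<open>\<bar>x\<bar> - 2 * \<bar>y\<bar>\<close>, which is
    below \<open>\<bar>x\<bar>\<close> because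
    \<open>0 < \<bar>y\<bar> < \<bar>x\<bar>\<close>.\<close>
  define j :: int where "j = (if (x > 0) = (y > 0) then -1 else 1)"
  have small: "\<bar>x + 2 * j * y\<bar> < \<bar>x\<bar>"
    using y by (auto simp: j_def)
  define a1 b1 where "a1 = a + 2 * k * x" and "b1 = b + 2 * k * x"
  have "pure_equiv (a # b # c # u) (a1 # b1 # c # u)"
    using pure_equiv_twist[of a b "c # u" k] by (simp add: a1_def b1_def x_def)
  also have "pure_equiv (a1 # b1 # c # u) (a1 # (b1 + 2 * j * (c - b1)) # (c + 2 * j * (c - b1)) # u)"
    by (intro pure_equiv_Cons pure_equiv_twist)
  finally show ?thesis
  proof (rule that)
    have "b1 + 2 * j * (c - b1) - a1 = x + 2 * j * y"
      by (simp add: a1_def b1_def y_def x_def algebra_simps)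
    then show "\<bar>b1 + 2 * j * (c - b1) - a1\<bar> < \<bar>b - a\<bar>"
      using small by (simp add: x_def)
  qed
qed

text \<open>Induction on the distance of the first two entries. While they differ, their even
  difference cannot divide the gcd 1, so some third entry allows it to be shrunk; parities survive
  each round.\<close>

lemma pure_equiv_equal_pair:
  assumes "diff_gcd (a # b # r) = 1" "even a = even b"
  obtains a' r' where "pure_equiv (a # b # r) (a' # a' # r')"
  using assms
proof (induction "nat \<bar>b - a\<bar>" arbitrary: a b r thesis rule: less_induct)
  case less
  show ?case
  proof (cases "a = b")
    case True
    then show ?thesis using less.prems(1) pure_equiv_refl by blast
  next
    case False
    have "even (b - a)" using less.prems(3) by simp
    then have "\<not> b - a dvd 1" using dvd_trans[of 2 "b - a" 1] by auto
    then have "\<not> b - a dvd diff_gcd (a # b # r)" using less.prems(2) by simp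
    then obtain c where "c \<in> set (a # b # r)" "\<not> b - a dvd c - b"
      using dvd_diff_gcd_iff_base[of b "a # b # r"] by auto
    moreover have "b - a dvd a - b" using dvd_diff_commute[of "b - a" a b] by simp
    ultimately have c: "c \<in> set r" "\<not> b - a dvd c - b" by auto
    obtain u where u: "\<And>a' b' c'. pure_equiv (a # b # c # u) (a' # b' # c' # u) \<Longrightarrow>
       \<exists>r'. pure_equiv (a # b # r) (a' # b' # r')"
      using pure_equiv_with_entry[OF c(1)] by metis
    obtain a' b' r' where eq: "pure_equiv (a # b # r) (a' # b' # r')" and lt: "\<bar>b' - a'\<bar> < \<bar>b - a\<bar>"
      using pure_equiv_shrink[OF c(2)] False u by metis
    have "map even (a' # b' # r') = map even (a # b # r)"
      using eq by (rule pure_equiv_map_even)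
    then have "even a' = even b'" using less.prems(3) by simp
    moreover have "diff_gcd (a' # b' # r') = 1"
      using pure_equiv_invariants(3)[OF eq] less.prems(2) by simp
    ultimately obtain a2 r2 where "pure_equiv (a' # b' # r') (a2 # a2 # r2)"
      using less.hyps[of b' a' r'] lt False by (metis nat_mono_iff zero_less_abs_iff right_minus_eq)
    then show ?thesis using less.prems(1) pure_equiv_trans[OF eq] by blast
  qed
qed

section \<open>Finding entries of suitable parity\<close>

text \<open>Two of the first three entries agree in parity. They are brought to the front unchanged
  by a braid that may fail to be pure, which conjugation will absorb.\<close>

lemma ex_same_parity_pair:
  assumes "length v \<ge> 3"
  obtains x a b r where "x \<in> braid_words (length v)" "word_act v x = a # b # r" "even a = even b"
proof -
  obtain a b c r where v: "v = a # b # c # r"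
    using assms by (auto simp: Suc_le_length_iff numeral_3_eq_3)
  consider "even a = even b" | "even b = even c" | "even a = even c" by blast
  then show ?thesis
  proof cases
    case 1
    then show ?thesis using that[of "[]" a b "c # r"] v by simp
  next
    case 2
    then show ?thesis
      using that[of "[Gen 1, Gen 2]" b c "(2 * c - (2 * b - a)) # r"]
      by (simp add: v braid_words_def dihedral_op_def numeral_2_eq_2)
  next
    case 3
    then show ?thesis
      using that[of "[Gen 2]" a c "(2 * c - b) # r"]
      by (simp add: v braid_words_def dihedral_op_def numeral_2_eq_2)
  qed
qed

text \<open>An even change of one entry, needed to turn it into \<open>t\<close>, is compensated at another entry.\<close>

lemma ex_same_Delta_with_entry:
  fixes v :: "int list"
  assumes "length v \<ge> 2" "x \<in> set v" "even x = even t"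
  obtains u where "t \<in> set u" "map even u = map even v" "Delta u = Delta v"
proof -
  obtain j where j: "j < length v" "v ! j = x" using assms(2) by (auto simp: in_set_conv_nth)
  define i where "i = (if j = 0 then 1 else 0 :: nat)"
  have i: "i < length v" "i \<noteq> j" using assms(1) by (auto simp: i_def)
  \<comment> \<open>With this sign the changes at \<open>i\<close> and \<open>j\<close> cancel in
    the alternating sum.\<close>
  define s :: int where "s = (-1) ^ (i + j) * (t - x)"
  define u where "u = v[j := t, i := v ! i - s]"
  show ?thesis
  proof (rule that)
    have "u ! j = t" "j < length u" using i j by (auto simp: u_def)
    then show "t \<in> set u" using nth_mem by blast
    have "even s" using assms(3) by (auto simp: s_def)
    then show "map even u = map even v"
      using assms(3) i j by (auto simp: u_def nth_list_update intro!: nth_equalityI split: if_splits)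
    have "(-1) ^ i * s = (-1) ^ j * (t - x)"
      by (simp add: s_def power_add flip: mult.assoc)
    then show "Delta u = Delta v"
      using i j by (simp add: u_def Delta_list_update algebra_simps)
  qed
qed

text \<open>Otherwise 2 would divide the gcd.\<close>

lemma ex_opposite_parity:
  assumes "diff_gcd (a # r) = 1"
  obtains x where "x \<in> set r" "even x \<noteq> even a"
proof -
  have "\<not> 2 dvd diff_gcd (a # r)" using assms by simp
  then show ?thesis
    using that dvd_diff_gcd_iff_base[of a "a # r" 2] by auto
qed

lemma diff_gcd_double: "diff_gcd (a # a # r) = diff_gcd (a # r)"
  by (simp add: diff_gcd_eq_Gcd)

section \<open>Moving an equal pair in steps of two\<close>

text \<open>The assumption \<open>IH\<close> is the claim for tuples with one entry fewer, applied
  to one copy of \<open>a\<close> with the rest. Induction on the distance from \<open>a\<close> to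
  \<open>b\<close>; \<open>n \<ge> 2\<close> leaves a second entry in \<open>r\<close> to absorb the
  change of \<open>Delta\<close>.\<close>

lemma pure_equiv_pairs:
  assumes IH: "\<And>v w. \<lbrakk>length v = Suc n; Delta v = Delta w; diff_gcd v = 1; diff_gcd w = 1;
      map even v = map even w\<rbrakk> \<Longrightarrow> pure_equiv v w"
    and n: "n \<ge> 2"
  shows "\<lbrakk>length r = n; Delta r = Delta s; diff_gcd (a # r) = 1; diff_gcd (b # s) = 1;
      map even (a # r) = map even (b # s)\<rbrakk> \<Longrightarrow> pure_equiv (a # a # r) (b # b # s)"
proof (induction "nat \<bar>b - a\<bar>" arbitrary: a r rule: less_induct)
  case less
  show ?case
  proof (cases "a = b")
    case True
    then show ?thesis using less.prems IH[of "a # r" "b # s"] by (auto intro: pure_equiv_Cons)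
  next
    case False
    define e where "e = sgn (b - a)"
    have e: "\<bar>e\<bar> = 1" using False by (simp add: e_def abs_sgn_eq)
    have par: "even a = even b" using less.prems(5) by simp
    obtain x where "x \<in> set r" "even x \<noteq> even a"
      using ex_opposite_parity[OF less.prems(3)] .
    moreover have "even (a + e) \<noteq> even a" using e by (auto simp: abs_if split: if_splits)
    ultimately obtain u where u: "a + e \<in> set u" "map even u = map even r" "Delta u = Delta r"
      using ex_same_Delta_with_entry[of r x "a + e"] less.prems(1) n by metis
    have len: "length u = n" using u(2) less.prems(1) by (metis length_map)
    \<comment> \<open>The neighbouring integers \<open>a\<close> and \<open>a + e\<close> force gcd
      1, so \<open>IH\<close> applies; the reflected pair below is again at distance 1 from
      \<open>a + e\<close>.\<close>
    have "diff_gcd (a # u) = 1"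
      by (rule diff_gcd_eq_1I[of "a + e" _ a]) (use u e in auto)
    then have "pure_equiv (a # r) (a # u)"
      using less.prems u by (intro IH) auto
    then have "pure_equiv (a # a # r) (a # a # u)" by (rule pure_equiv_Cons)
    also have "pure_equiv (a # a # u) ((2 * (a + e) - a) # (2 * (a + e) - a) # u)"
      by (rule pure_equiv_reflect_pair[OF u(1)])
    also have "2 * (a + e) - a = a + 2 * e" by simp
    also have "pure_equiv ((a + 2 * e) # (a + 2 * e) # u) (b # b # s)"
    proof (rule less.hyps)
      \<comment> \<open>The distance is even and nonzero, so a step of two towards \<open>b\<close>
        does not overshoot.\<close>
      have "even (b - a)" using par by simp
      then obtain k where "b - a = 2 * k" by (elim evenE)
      then have "\<bar>b - a\<bar> \<ge> 2" using False by arith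
      then show "nat \<bar>b - (a + 2 * e)\<bar> < nat \<bar>b - a\<bar>"
        by (auto simp: e_def sgn_if split: if_splits)
      show "diff_gcd ((a + 2 * e) # u) = 1"
        by (rule diff_gcd_eq_1I[of "a + e" _ "a + 2 * e"]) (use u e in auto)
    qed (use less.prems u len in auto)
    finally show ?thesis .
  qed
qed

section \<open>Induction on the length of the tuple\<close>

lemma diff_gcd_two: "diff_gcd [a, b] = \<bar>a - b\<bar>"
proof (rule zdvd_antisym_nonneg)
  show "diff_gcd [a, b] dvd \<bar>a - b\<bar>" using diff_gcd_dvd_diff[of a "[a, b]" b] by simp
  show "\<bar>a - b\<bar> dvd diff_gcd [a, b]"
    using dvd_diff_gcd_iff_base[of b "[a, b]" "\<bar>a - b\<bar>"] by simp
qed (simp_all add: diff_gcd_nonneg)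

lemma pure_equiv_length_2:
  assumes "length v = 2" "Delta v = Delta w" "diff_gcd v = 1" "map even v = map even w"
  shows "pure_equiv v w"
proof -
  have "length w = 2" using assms by (metis length_map)
  then obtain a b c d where v: "v = [a, b]" and w: "w = [c, d]"
    using assms(1) by (auto simp: length_Suc_conv numeral_2_eq_2)
  have d: "\<bar>b - a\<bar> = 1" using assms(3) by (simp add: v diff_gcd_two abs_minus_commute)
  have "even (c - a)" using assms(4) by (simp add: v w)
  then obtain k where k: "c - a = 2 * k" by (elim evenE)
  \<comment> \<open>As \<open>b - a\<close> is 1 or -1, twisting \<open>k * (b - a)\<close> times
    shifts both entries by exactly \<open>2 * k\<close>.\<close>
  have "(b - a) * (b - a) = 1" using abs_mult_self_eq[of "b - a"] by (simp only: d)
  then have 2: "2 * (k * (b - a)) * (b - a) = 2 * k" by (simp add: mult.assoc)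
  have "c = a + 2 * k" "d = b + 2 * k" using k assms(2) by (simp_all add: v w)
  then show ?thesis
    using pure_equiv_twist[of a b "[]" "k * (b - a)"] unfolding v w 2 by simp
qed

lemma pure_equiv_coprime:
  assumes "length v \<ge> 2" "Delta v = Delta w" "diff_gcd v = 1" "diff_gcd w = 1"
    "map even v = map even w"
  shows "pure_equiv v w"
  using assms
proof (induction "length v" arbitrary: v w rule: less_induct)
  case less
  show ?case
  proof (cases "length v = 2")
    case True
    then show ?thesis using less.prems pure_equiv_length_2 by blast
  next
    case False
    then have m: "length v \<ge> 3" using less.prems(1) by simp
    have len: "length w = length v" using less.prems(5) by (metis length_map)
    obtain x a b r where x: "x \<in> braid_words (length v)" "word_act v x = a # b # r"
      and par: "even a = even b"
      using ex_same_parity_pair[OF m] .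
    have "Suc (Suc (Suc 0)) \<le> length (word_act w x)" using m len by simp
    then obtain c d s where w: "word_act w x = c # d # s"
      by (auto simp only: Suc_le_length_iff)
    \<comment> \<open>The same \<open>x\<close> acts on \<open>w\<close>, so \<open>c\<close> and
      \<open>d\<close> inherit the equal parity of \<open>a\<close> and \<open>b\<close>.\<close>
    have ev: "map even (a # b # r) = map even (c # d # s)"
      using map_even_word_act[OF x(1) less.prems(5)] by (simp add: x w)
    have dg: "diff_gcd (a # b # r) = 1" "diff_gcd (c # d # s) = 1"
      "Delta (a # b # r) = Delta (c # d # s)"
      using diff_gcd_word_act[of x v] diff_gcd_word_act[of x w]
        Delta_word_act[of x v] Delta_word_act[of x w] x w len less.prems by auto
    obtain a' r' where v': "pure_equiv (a # b # r) (a' # a' # r')"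
      using pure_equiv_equal_pair[OF dg(1) par] .
    obtain c' s' where w': "pure_equiv (c # d # s) (c' # c' # s')"
      using pure_equiv_equal_pair[OF dg(2)] par ev by auto
    have ev': "map even (a' # r') = map even (c' # s')"
      using pure_equiv_map_even[OF v'] pure_equiv_map_even[OF w'] ev by simp
    have dg': "diff_gcd (a' # r') = 1" "diff_gcd (c' # s') = 1" "Delta r' = Delta s'"
      using pure_equiv_invariants(2,3)[OF v'] pure_equiv_invariants(2,3)[OF w'] dg
      by (simp_all add: diff_gcd_double)
    have len': "length v = Suc (Suc (length r'))" "length s' = length r'"
      using pure_equiv_invariants(1)[OF v'] x(2) length_word_act[of v x] ev' map_eq_imp_length_eq[OF ev']
      by simp_all
    have "pure_equiv (a' # a' # r') (c' # c' # s')"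
    proof (cases "length r' = 1")
      case True
      then obtain p q where p: "r' = [p]" "s' = [q]"
        using len' by (auto simp: length_Suc_conv)
      \<comment> \<open>Three strands: \<open>Delta\<close> fixes the single remaining entry
        \<open>p\<close>, and both pair values lie at distance 1 from it. They are equal or mirror
        images in \<open>p\<close>, so at most one reflection is required.\<close>
      then have "q = p" "\<bar>a' - p\<bar> = 1" "\<bar>c' - p\<bar> = 1"
        using dg' by (simp_all add: diff_gcd_two)
      then have "c' = a' \<or> c' = 2 * p - a'" by linarith
      then show ?thesis
        using pure_equiv_reflect_pair[of p "[p]" a'] pure_equiv_refl p \<open>q = p\<close> by auto
    next
      case False
      then have "length r' \<ge> 2" using m len' by simp
      then show ?thesis
        using less.hyps len' dg' ev'
        by (intro pure_equiv_pairs[of "length r'"]) auto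
    qed
    then have "pure_equiv (a # b # r) (c # d # s)"
      using v' w' pure_equiv_sym pure_equiv_trans by blast
    then show ?thesis
      using pure_equiv_conjugate[OF x(1) len] x w by simp
  qed
qed

section \<open>Scaling\<close>

text \<open>Affine maps respect the operation \<open>2 * b - a\<close>, so they commute with the
  Hurwitz action.\<close>

lemma letter_act_affine:
  assumes "[g] \<in> braid_words (length v)"
  shows "letter_act (map (\<lambda>x. d * x + c) v) g = map (\<lambda>x. d * x + c) (letter_act v g)"
  using assms
  by (cases g) (auto simp: braid_words_def dihedral_op_def map_update algebra_simps)

lemma word_act_affine:
  "x \<in> braid_words (length v) \<Longrightarrow>
    word_act (map (\<lambda>x. d * x + c) v) x = map (\<lambda>x. d * x + c) (word_act v x)"
  by (induction x arbitrary: v) (auto simp: letter_act_affine)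

lemma pure_equiv_affine:
  "pure_equiv v w \<Longrightarrow> pure_equiv (map (\<lambda>x. d * x + c) v) (map (\<lambda>x. d * x + c) w)"
  by (auto simp: pure_equiv_def word_act_affine)

lemma diff_gcd_affine: "diff_gcd (map (\<lambda>x. d * x + c) v) = \<bar>d\<bar> * diff_gcd v"
proof -
  have eq: "{x - y | x y. x \<in> f ` A \<and> y \<in> f ` A} = (\<lambda>(x, y). f x - f y) ` (A \<times> A)"
    for f :: "int \<Rightarrow> int" and A
    by auto
  have eq': "{x - y | x y. x \<in> A \<and> y \<in> A} = (\<lambda>(x, y). x - y) ` (A \<times> A)" for A :: "int set"
    by auto
  have "(\<lambda>(x, y). d * x + c - (d * y + c)) ` (set v \<times> set v) =
      (*) d ` (\<lambda>(x, y). x - y) ` (set v \<times> set v)"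
    by (simp add: image_image case_prod_unfold right_diff_distrib)
  then show ?thesis
    unfolding diff_gcd_eq_Gcd set_map eq eq' by (simp add: Gcd_mult abs_mult)
qed

lemma cong_class_eq_iff: "cong_class n a = cong_class n b \<longleftrightarrow> n dvd b - a"
proof -
  have "cong_class n a = cong_class n b \<longleftrightarrow> [a = b] (mod n)"
    unfolding cong_class_def set_eq_iff mem_Collect_eq by (meson cong_refl cong_sym cong_trans)
  then show ?thesis by (simp add: cong_iff_dvd_diff dvd_diff_commute)
qed

lemma M_star_eq_iff:
  assumes "diff_gcd v = diff_gcd w" "length v = length w"
  shows "M_star v = M_star w \<longleftrightarrow> (\<forall>i<length v. 2 * diff_gcd v dvd w ! i - v ! i)"
  using assms by (auto simp: M_star_def list_eq_iff_nth_eq cong_class_eq_iff)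

lemma pure_equiv_of_invariants:
  assumes len: "length v \<ge> 2" "length w = length v"
    and inv: "Delta v = Delta w" "diff_gcd v = diff_gcd w"
    and cong: "\<And>i. i < length v \<Longrightarrow> 2 * diff_gcd v dvd w ! i - v ! i"
  shows "pure_equiv v w"
proof (cases "diff_gcd v = 0")
  case True
  \<comment> \<open>Here the modulus is 0, and divisibility by 0 means equality.\<close>
  then have "w = v" using len cong by (intro nth_equalityI) auto
  then show ?thesis by (simp add: pure_equiv_refl)
next
  case False
  define d where "d = diff_gcd v"
  \<comment> \<open>One base point serves both tuples, because the entries of \<open>w\<close> are
    congruent to those of \<open>v\<close> modulo \<open>d\<close>.\<close>
  define c where "c = v ! 0"
  define norm where "norm = (\<lambda>x. (x - c) div d)"
  have d: "d > 0" using False diff_gcd_nonneg[of v] by (simp add: d_def)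
  have dv: "d dvd v ! i - c" if "i < length v" for i
    unfolding d_def c_def using that len by (intro diff_gcd_dvd_diff nth_mem) auto
  have dw: "d dvd w ! i - c" if "i < length v" for i
  proof -
    have "d dvd w ! i - v ! i" using cong[OF that] by (metis d_def dvd_mult_right)
    then show ?thesis using dvd_add[OF _ dv[OF that]] by fastforce
  qed
  have v: "v = map (\<lambda>x. d * x + c) (map norm v)"
    using dv by (intro nth_equalityI) (auto simp: norm_def)
  have w: "w = map (\<lambda>x. d * x + c) (map norm w)"
    using dw len by (intro nth_equalityI) (auto simp: norm_def)
  have "pure_equiv (map norm v) (map norm w)"
  proof (rule pure_equiv_coprime)
    show "Delta (map norm v) = Delta (map norm w)"
      using inv(1) Delta_affine[of d c "map norm v", folded v]
        Delta_affine[of d c "map norm w", folded w] d len by simp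
    show "diff_gcd (map norm v) = 1"
      using diff_gcd_affine[of d c "map norm v", folded v] d by (simp add: d_def)
    show "diff_gcd (map norm w) = 1"
      using diff_gcd_affine[of d c "map norm w", folded w] d inv(2) by (simp add: d_def)
    show "map even (map norm v) = map even (map norm w)"
    proof (rule nth_equalityI)
      fix i assume "i < length (map even (map norm v))"
      then have i: "i < length v" by simp
      \<comment> \<open>After division by \<open>d\<close>, congruence modulo \<open>2 * d\<close>
        becomes equality of parities.\<close>
      have "2 * d dvd (w ! i - c) - (v ! i - c)" using cong[OF i] by (simp add: d_def)
      also have "(w ! i - c) - (v ! i - c) = (norm (w ! i) - norm (v ! i)) * d"
        using dv[OF i] dw[OF i] by (simp add: norm_def left_diff_distrib)
      finally have "even (norm (w ! i) - norm (v ! i))" using d by simp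
      then show "map even (map norm v) ! i = map even (map norm w) ! i"
        using i len by simp
    qed (use len in simp)
  qed (use len in simp)
  then show ?thesis using pure_equiv_affine[of _ _ d c] v w by metis
qed

theorem theorem1p2:
  fixes m :: nat and v w :: "int list"
  assumes "m \<ge> 2" and "length v = m" and "length w = m"
  shows "(\<exists>\<beta>\<in>pure_braid_group m. hurwitz v \<beta> = w) \<longleftrightarrow>
         (Delta v = Delta w \<and> diff_gcd v = diff_gcd w \<and> M_star v = M_star w)"
  unfolding ex_pure_braid_iff[OF assms(2)]
proof
  assume "pure_equiv v w"
  note inv = pure_equiv_invariants[OF this]
  then show "Delta v = Delta w \<and> diff_gcd v = diff_gcd w \<and> M_star v = M_star w"
    using M_star_eq_iff[of v w] by simp
next
  assume "Delta v = Delta w \<and> diff_gcd v = diff_gcd w \<and> M_star v = M_star w"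
  then show "pure_equiv v w"
    using pure_equiv_of_invariants[of v w] M_star_eq_iff[of v w] assms by auto
qed

end
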